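(* Let $\mathcal{B}$ be the Lie conformal algebra of Block type, i.e. the free $\mathbb{C}[\partial]$-module with basis $\{J_i \mid i\in\mathbb{Z}^+\}$ and $\lambda$-bracket determined by $[J_{i\,\lambda}J_j]=((i+1)\partial+(i+j+2)\lambda)J_{i+j}$ for $i,j\in\mathbb{Z}^+$. Then all nontrivial conformal $\mathcal{B}$-modules that are free of rank $1$ over $\mathbb{C}[\partial]$ are the following ones, where $\Delta,\alpha\in\mathbb{C}$: $$M_{\Delta,\alpha}=\mathbb{C}[\partial]v,\qquad J_{0\,\lambda}v=(\partial+\alpha+\Delta\lambda)v,\qquad J_{i\,\lambda}v=0\ \text{ for } i>0.$$
   Context: $\mathbb{Z}^+$ denotes the set of nonnegative integers; all vector spaces are over $\mathbb{C}$. A Lie conformal algebra $\mathcal{R}$ is a $\mathbb{C}[\partial]$-module with a $\mathbb{C}$-bilinear map $\mathcal{R}\otimes\mathcal{R}\to\mathbb{C}[\lambda]\otimes\mathcal{R}$, $a\otimes b\mapsto[a_\lambda b]$, such that for $a,b,c\in\mathcal{R}$: $[\partial a_\lambda b]=-\lambda[a_\lambda b]$, $[a_\lambda\partial b]=(\partial+\lambda)[a_\lambda b]$; $[a_\lambda b]=-[b_{-\lambda-\partial}a]$; $[a_\lambda[b_\mu c]]=[[a_\lambda b]_{\lambda+\mu}c]+[b_\mu[a_\lambda c]]$. The bracket of $\mathcal{B}$ is extended from the basis elements $J_i$ to all of $\mathcal{B}$ by the first pair of identities. A (conformal) module over $\mathcal{R}$ is a $\mathbb{C}[\partial]$-module $M$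 with a bilinear map $\mathcal{R}\otimes M\to M[\lambda]$, $a\otimes v\mapsto a_\lambda v$, such that for $a,b\in\mathcal{R}$, $v\in M$: $a_\lambda(b_\mu v)-b_\mu(a_\lambda v)=[a_\lambda b]_{\lambda+\mu}v$, $(\partial a)_\lambda v=-\lambda a_\lambda v$, and $a_\lambda(\partial v)=(\partial+\lambda)a_\lambda v$. Here "nontrivial" means that the action $a_\lambda v$ of $\mathcal{B}$ is not identically zero. The action on $M_{\Delta,\alpha}$ is extended to all of $\mathcal{B}$ and all of $\mathbb{C}[\partial]v$ by the last two identities. *)

theory Defs
  imports "HOL-Library.Poly_Mapping" "HOL-Computational_Algebra.Polynomial"
begin

text \<open>
  A \<open>\<complex>[\<partial>]\<close>-module is a \<^locale>\<open>module\<close> over \<^typ>\<open>complex poly\<close>; the indeterminate acts as \<open>\<partial>\<close> and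
  the constant polynomials as the complex scalars.  For a module on the type \<^typ>\<open>'m\<close>, the space
  \<open>M[\<lambda>]\<close> is \<^typ>\<open>'m poly\<close>, and \<open>M[\<lambda>,\<mu>]\<close> is \<^typ>\<open>'m poly poly\<close> with inner variable \<open>\<lambda>\<close> and outer
  variable \<open>\<mu>\<close>.
\<close>

definition dd :: "(complex poly \<Rightarrow> 'm::ab_group_add \<Rightarrow> 'm) \<Rightarrow> 'm \<Rightarrow> 'm" where
  "dd s x = s [:0, 1:] x"

text \<open>
  Multiplication by \<open>\<lambda>\<close> on \<open>M[\<lambda>]\<close> and by \<open>\<mu>\<close> on \<open>M[\<lambda>,\<mu>]\<close> are both \<^term>\<open>pCons 0\<close>; multiplication
  by \<open>\<lambda>\<close> on \<open>M[\<lambda>,\<mu>]\<close> is the following map.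
\<close>

definition mul_inner :: "'m::zero poly poly \<Rightarrow> 'm poly poly" where
  "mul_inner = map_poly (pCons 0)"

text \<open>
  Substitution of an operator \<open>T\<close> for the variable: \<open>\<Sum>n. p\<^sub>n x\<^sup>n\<close> becomes \<open>\<Sum>n. T\<^sup>n (e p\<^sub>n)\<close>, where
  \<open>e\<close> maps the coefficients into the space on which \<open>T\<close> operates.
\<close>

definition subst_op :: "('b \<Rightarrow> 'b) \<Rightarrow> ('a::zero \<Rightarrow> 'b) \<Rightarrow> 'a poly \<Rightarrow> 'b::comm_monoid_add" where
  "subst_op T e p = (\<Sum>n\<le>Polynomial.degree p. (T ^^ n) (e (coeff p n)))"

text \<open>
  The following three terms are, in \<open>M[\<lambda>,\<mu>]\<close>, the elements \<open>a\<^sub>\<lambda> (b\<^sub>\<mu> v)\<close>, \<open>b\<^sub>\<mu> (a\<^sub>\<lambda> v)\<close> and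
  \<open>[a\<^sub>\<lambda> b]\<^bsub>\<lambda>+\<mu>\<^esub> v\<close>.
\<close>

definition act_lam_mu :: "('r \<Rightarrow> 'm \<Rightarrow> 'm::ab_group_add poly) \<Rightarrow> 'r \<Rightarrow> 'r \<Rightarrow> 'm \<Rightarrow> 'm poly poly" where
  "act_lam_mu act a b v = map_poly (act a) (act b v)"

definition act_mu_lam :: "('r \<Rightarrow> 'm \<Rightarrow> 'm::ab_group_add poly) \<Rightarrow> 'r \<Rightarrow> 'r \<Rightarrow> 'm \<Rightarrow> 'm poly poly" where
  "act_mu_lam act b a v =
     subst_op mul_inner (\<lambda>x. map_poly (\<lambda>y. [:y:]) (act b x)) (act a v)"

definition act_bracket ::
  "('r::zero \<Rightarrow> 'r \<Rightarrow> 'r poly) \<Rightarrow> ('r \<Rightarrow> 'm \<Rightarrow> 'm::ab_group_add poly) \<Rightarrow> 'r \<Rightarrow> 'r \<Rightarrow> 'm \<Rightarrow> 'm poly poly"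
where
  "act_bracket br act a b v =
     subst_op mul_inner
       (\<lambda>c. subst_op (\<lambda>q. mul_inner q + pCons 0 q) (\<lambda>x. [:[:x:]:]) (act c v))
       (br a b)"

locale lie_conformal_algebra = module sR
  for sR :: "complex poly \<Rightarrow> 'r::ab_group_add \<Rightarrow> 'r" +
  fixes br :: "'r \<Rightarrow> 'r \<Rightarrow> 'r poly"
  assumes br_add_left: "br (a + b) c = br a c + br b c"
    and br_add_right: "br a (b + c) = br a b + br a c"
    and br_scale_left: "br (sR [:z:] a) b = map_poly (sR [:z:]) (br a b)"
    and br_scale_right: "br a (sR [:z:] b) = map_poly (sR [:z:]) (br a b)"
    and br_dd_left: "br (dd sR a) b = - pCons 0 (br a b)"
    and br_dd_right: "br a (dd sR b) = map_poly (dd sR) (br a b) + pCons 0 (br a b)"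
    and br_skew: "br a b =
          - subst_op (\<lambda>q. - pCons 0 q - map_poly (dd sR) q) (\<lambda>x. [:x:]) (br b a)"
    and br_jacobi: "act_lam_mu br a b c = act_bracket br br a b c + act_mu_lam br b a c"

locale conformal_module = lie_conformal_algebra sR br + M: module sM
  for sR :: "complex poly \<Rightarrow> 'r::ab_group_add \<Rightarrow> 'r"
    and br :: "'r \<Rightarrow> 'r \<Rightarrow> 'r poly"
    and sM :: "complex poly \<Rightarrow> 'm::ab_group_add \<Rightarrow> 'm" +
  fixes act :: "'r \<Rightarrow> 'm \<Rightarrow> 'm poly"
  assumes act_add_left: "act (a + b) v = act a v + act b v"
    and act_add_right: "act a (v + w) = act a v + act a w"
    and act_scale_left: "act (sR [:z:] a) v = map_poly (sM [:z:]) (act a v)"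
    and act_scale_right: "act a (sM [:z:] v) = map_poly (sM [:z:]) (act a v)"
    and act_commutator: "act_lam_mu act a b v - act_mu_lam act b a v = act_bracket br act a b v"
    and act_dd_left: "act (dd sR a) v = - pCons 0 (act a v)"
    and act_dd_right: "act a (dd sM v) = map_poly (dd sM) (act a v) + pCons 0 (act a v)"

definition nontrivial_action :: "('r \<Rightarrow> 'm \<Rightarrow> 'm::zero poly) \<Rightarrow> bool" where
  "nontrivial_action act \<longleftrightarrow> (\<exists>a v. act a v \<noteq> 0)"

definition free_rank_one :: "('k::comm_ring_1 \<Rightarrow> 'm::ab_group_add \<Rightarrow> 'm) \<Rightarrow> bool" where
  "free_rank_one s \<longleftrightarrow> (\<exists>v. \<not> module.dependent s {v} \<and> module.span s {v} = UNIV)"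

definition conformal_module_isomorphic ::
  "(complex poly \<Rightarrow> 'm::ab_group_add \<Rightarrow> 'm) \<Rightarrow> ('r \<Rightarrow> 'm \<Rightarrow> 'm poly) \<Rightarrow>
   (complex poly \<Rightarrow> 'n::ab_group_add \<Rightarrow> 'n) \<Rightarrow> ('r \<Rightarrow> 'n \<Rightarrow> 'n poly) \<Rightarrow> bool" where
  "conformal_module_isomorphic sM actM sN actN \<longleftrightarrow>
     (\<exists>\<phi>. module_hom sM sN \<phi> \<and> bij \<phi> \<and> (\<forall>a v. map_poly \<phi> (actM a v) = actN a (\<phi> v)))"

text \<open>
  The free \<open>\<complex>[\<partial>]\<close>-module with basis \<open>J\<^sub>0, J\<^sub>1, \<dots>\<close>: finitely supported families of coefficients in
  \<open>\<complex>[\<partial>]\<close>.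
\<close>

type_synonym block = "nat \<Rightarrow>\<^sub>0 complex poly"

definition block_scale :: "complex poly \<Rightarrow> block \<Rightarrow> block" where
  "block_scale p x = Poly_Mapping.map ((*) p) x"

definition J :: "nat \<Rightarrow> block" where
  "J i = Poly_Mapping.single i 1"

text \<open>
  Elements of \<open>\<complex>[\<partial>][\<lambda>]\<close> are of type \<^typ>\<open>complex poly poly\<close>, with inner variable \<open>\<partial>\<close> and outer
  variable \<open>\<lambda>\<close>.  From \<open>p(\<partial>)\<close> we form \<open>p(-\<lambda>)\<close> and \<open>p(\<partial> + \<lambda>)\<close>.
\<close>

definition at_minus_lam :: "complex poly \<Rightarrow> complex poly poly" where
  "at_minus_lam p = pcompose (map_poly (\<lambda>c. [:c:]) p) [:0, -1:]"

definition at_dd_plus_lam :: "complex poly \<Rightarrow> complex poly poly" where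
  "at_dd_plus_lam p = pcompose (map_poly (\<lambda>c. [:c:]) p) [:[:0, 1:], 1:]"

text \<open>
  The sesquilinear extension
  \<open>[p(\<partial>)J\<^sub>i \<^sub>\<lambda> q(\<partial>)J\<^sub>j] = p(-\<lambda>) q(\<partial>+\<lambda>) ((i+1)\<partial> + (i+j+2)\<lambda>) J\<^bsub>i+j\<^esub>\<close>.
\<close>

definition block_bracket :: "block \<Rightarrow> block \<Rightarrow> block poly" where
  "block_bracket x y =
     (\<Sum>i\<in>Poly_Mapping.keys x. \<Sum>j\<in>Poly_Mapping.keys y.
        map_poly (Poly_Mapping.single (i + j))
          (at_minus_lam (Poly_Mapping.lookup x i) * at_dd_plus_lam (Poly_Mapping.lookup y j) *
           [:[:0, of_nat (i + 1):], [:of_nat (i + j + 2):]:]))"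

text \<open>
  \<open>M\<^bsub>\<Delta>,\<alpha>\<^esub>\<close> is \<open>\<complex>[\<partial>]\<close> acting on itself by multiplication, with \<open>v = 1\<close>; again
  \<open>(p(\<partial>)J\<^sub>i) \<^sub>\<lambda> (q(\<partial>)v) = p(-\<lambda>) q(\<partial>+\<lambda>) (J\<^sub>i \<^sub>\<lambda> v)\<close>.
\<close>

definition M_gen :: "complex \<Rightarrow> complex \<Rightarrow> nat \<Rightarrow> complex poly poly" where
  "M_gen \<Delta> \<alpha> i = (if i = 0 then [:[:\<alpha>, 1:], [:\<Delta>:]:] else 0)"

definition M_act :: "complex \<Rightarrow> complex \<Rightarrow> block \<Rightarrow> complex poly \<Rightarrow> complex poly poly" where
  "M_act \<Delta> \<alpha> x q =
     (\<Sum>i\<in>Poly_Mapping.keys x.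
        at_minus_lam (Poly_Mapping.lookup x i) * at_dd_plus_lam q * M_gen \<Delta> \<alpha> i)"

lemma at_minus_lam_1 [simp]: "at_minus_lam 1 = 1"
  by (simp add: at_minus_lam_def one_pCons map_poly_pCons)

lemma at_dd_plus_lam_1 [simp]: "at_dd_plus_lam 1 = 1"
  by (simp add: at_dd_plus_lam_def one_pCons map_poly_pCons)

lemma block_bracket_J:
  "block_bracket (J i) (J j) =
     [: Poly_Mapping.single (i + j) [:0, of_nat (i + 1):],
        Poly_Mapping.single (i + j) [:of_nat (i + j + 2):] :]"
  by (simp add: block_bracket_def J_def map_poly_pCons del: of_nat_add of_nat_Suc)

lemma M_act_J: "M_act \<Delta> \<alpha> (J i) 1 = (if i = 0 then [:[:\<alpha>, 1:], [:\<Delta>:]:] else 0)"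
  by (simp add: M_act_def J_def M_gen_def)

lemma lookup_block_scale [simp]:
  "Poly_Mapping.lookup (block_scale p x) i = p * Poly_Mapping.lookup x i"
  by (simp add: block_scale_def Poly_Mapping.map.rep_eq when_def)

lemma module_block_scale: "module block_scale"
  by standard (rule poly_mapping_eqI, simp add: lookup_add algebra_simps)+

lemma block_expand: "x = (\<Sum>i\<in>Poly_Mapping.keys x. block_scale (Poly_Mapping.lookup x i) (J i))"
  by (rule poly_mapping_eqI)
    (auto simp: lookup_sum J_def lookup_single when_def if_distrib sum.delta in_keys_iff
      cong: if_cong)

lemma span_J: "module.span block_scale (range J) = UNIV"
proof -
  interpret module block_scale by (rule module_block_scale)
  have "x \<in> span (range J)" for x
    by (subst block_expand) (intro span_sum span_scale span_base rangeI)
  then show ?thesis by blast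
qed

lemma inj_J: "inj J"
  by (auto simp: inj_on_def J_def poly_mapping_eq_iff fun_eq_iff lookup_single when_def
      split: if_splits)

lemma independent_J: "\<not> module.dependent block_scale (range J)"
proof -
  interpret module block_scale by (rule module_block_scale)
  show ?thesis
    unfolding dependent_explicit
  proof safe
    fix T u w
    assume T: "finite T" "T \<subseteq> range J" and s: "(\<Sum>v\<in>T. block_scale (u v) v) = 0"
      and w: "w \<in> T" "u w \<noteq> 0"
    from T(2) w(1) obtain k where k: "w = J k" by blast
    have *: "Poly_Mapping.lookup v k = (if v = J k then 1 else 0)" if "v \<in> T" for v
      using that T(2) inj_J by (auto simp: J_def lookup_single when_def dest: injD)
    have "0 = (\<Sum>v\<in>T. u v * Poly_Mapping.lookup v k)"
      using arg_cong[OF s, of "\<lambda>x. Poly_Mapping.lookup x k"] by (simp add: lookup_sum)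
    also have "\<dots> = (\<Sum>v\<in>T. if v = J k then u v else 0)"
      by (rule sum.cong) (auto simp: *)
    finally have "0 = (\<Sum>v\<in>T. if v = J k then u v else 0)" .
    with T(1) w k show False by simp
  qed
qed

end

theory Submission
  imports Defs "HOL-Computational_Algebra.Formal_Power_Series"
begin

text \<open>
  Evaluating all variables at complex numbers turns identities in \<open>M[\<lambda>,\<mu>]\<close> into identities between
  complex functions; this makes the axioms for \<open>\<B>\<close> and \<open>M\<^bsub>\<Delta>,\<alpha>\<^esub>\<close> routine.  For the classification,
  write \<open>J\<^sub>i \<^sub>\<lambda> v = F\<^sub>i(\<partial>,\<lambda>) v\<close>.  The module axioms become
  \<open>F\<^sub>i(x,y) F\<^sub>j(x+y,z) - F\<^sub>j(x,z) F\<^sub>i(x+z,y) = ((j+1)y - (i+1)z) F\<^bsub>i+j\<^esub>(x,y+z)\<close>.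
  If \<open>F\<^sub>0 = 0\<close>, the case \<open>i = 0\<close> kills every \<open>F\<^sub>j\<close>.  Otherwise comparing degrees in \<open>z\<close> for
  \<open>i = j = 0\<close> gives \<open>F\<^sub>0(x,z) = x + \<alpha> + \<Delta>z\<close>.  With \<open>i = 0\<close>, \<open>z = 0\<close>, \<open>y \<rightarrow> 0\<close> the polynomial
  \<open>F\<^sub>j(x - \<alpha>, 0)\<close> satisfies Euler's equation, so it is \<open>c x\<^bsup>j+1\<^esup>\<close>, and this determines \<open>F\<^sub>j\<close>.  Finally, for
  \<open>i = j > 0\<close>, \<open>z = 0\<close> and \<open>n = i + 1\<close>, \<open>F\<^bsub>2i\<^esub>\<close> being of the same shape forces \<open>(n - 1)\<^sup>2 c\<^sup>2 = 0\<close>.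
\<close>

section \<open>Evaluation of polynomials with coefficients in a module\<close>


text \<open>The argument \<open>e\<close> is a functional on the coefficients, so the construction
  iterates: \<open>eval_at (eval_at e y) z\<close> sets the inner variable to \<open>y\<close> and
  the outer one to \<open>z\<close>.\<close>

definition eval_at :: "('a::zero \<Rightarrow> complex) \<Rightarrow> complex \<Rightarrow> 'a poly \<Rightarrow> complex" where
  "eval_at e z p = poly (map_poly e p) z"

text \<open>The degree of \<open>map_poly e p\<close> varies with \<open>e\<close>. Summing up to
  the degree of \<open>p\<close> instead makes the value visibly linear in \<open>e\<close>, as
  \<open>eval_at_mult\<close> and \<open>eval_at_sum\<close> need.\<close>

lemma eval_at_altdef:
  assumes "e 0 = 0"
  shows "eval_at e z p = (\<Sum>n\<le>Polynomial.degree p. e (coeff p n) * z ^ n)"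
proof -
  have "eval_at e z p = (\<Sum>n\<le>Polynomial.degree (map_poly e p). e (coeff p n) * z ^ n)"
    using assms by (simp add: eval_at_def poly_altdef coeff_map_poly)
  also have "\<dots> = (\<Sum>n\<le>Polynomial.degree p. e (coeff p n) * z ^ n)"
    using map_poly_degree_leq[of e p] assms
    by (intro sum.mono_neutral_left) (auto simp: not_le coeff_map_poly[symmetric, of e] coeff_eq_0)
  finally show ?thesis .
qed

lemma eval_at_0 [simp]: "eval_at e z 0 = 0"
  by (simp add: eval_at_def)

lemma eval_at_pCons: "e 0 = 0 \<Longrightarrow> eval_at e z (pCons a p) = e a + z * eval_at e z p"
  by (simp add: eval_at_def map_poly_pCons)

lemma additive_eval_at:
  assumes "additive e"
  shows "additive (eval_at e z)"
proof
  interpret additive e by fact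
  have "map_poly e (p + q) = map_poly e p + map_poly e q" for p q
    by (rule poly_eqI) (simp add: coeff_map_poly zero add)
  then show "eval_at e z (p + q) = eval_at e z p + eval_at e z q" for p q
    by (simp add: eval_at_def)
qed

lemma eval_at_map_poly:
  assumes "g 0 = 0" "e 0 = 0"
  shows "eval_at e z (map_poly g p) = eval_at (\<lambda>x. e (g x)) z p"
  using assms by (simp add: eval_at_def map_poly_map_poly comp_def)

lemma eval_at_mult:
  assumes "e 0 = 0"
  shows "eval_at (\<lambda>x. c * e x) z p = c * eval_at e z p"
  using assms by (simp add: eval_at_altdef sum_distrib_left mult.assoc)

lemma eval_at_sum:
  assumes "\<And>i. i \<in> A \<Longrightarrow> e i 0 = 0"
  shows "eval_at (\<lambda>x. \<Sum>i\<in>A. c i * e i x * d i) z p = (\<Sum>i\<in>A. c i * eval_at (e i) z p * d i)"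
  using assms
  by (simp add: eval_at_altdef sum_distrib_left sum_distrib_right sum.swap[of _ A] mult_ac)

text \<open>The functional \<open>E\<close> turns each power of \<open>T\<close> into the same power
  of \<open>t\<close>. Every substitution of an operator in the axioms thereby becomes an evaluation
  at a complex number.\<close>

lemma eval_at_subst_op:
  assumes E: "additive E" and T: "\<And>q. E (T q) = t * E q" and g: "E (g 0) = 0"
  shows "E (subst_op T g p) = eval_at (\<lambda>x. E (g x)) t p"
proof -
  have *: "E ((T ^^ n) q) = t ^ n * E q" for n q
    by (induction n) (simp_all add: T)
  show ?thesis
    using g by (simp add: subst_op_def additive.sum[OF E] * eval_at_altdef mult.commute)
qed

text \<open>A complex polynomial is determined by its values, so every \<open>e\<close> agrees on
  all coefficients, and \<open>S\<close> separates these.\<close>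

lemma eval_at_separates:
  fixes p q :: "'a::zero poly"
  assumes sep: "\<And>x y :: 'a. (\<And>e. e \<in> S \<Longrightarrow> e x = e y) \<Longrightarrow> x = y"
    and zero: "\<And>e. e \<in> S \<Longrightarrow> e 0 = 0"
    and eq: "\<And>e z. e \<in> S \<Longrightarrow> eval_at e z p = eval_at e z q"
  shows "p = q"
proof (rule poly_eqI, rule sep)
  fix n e assume e: "e \<in> S"
  have "map_poly e p = map_poly e q"
    using eq[OF e] by (simp add: eval_at_def fun_eq_iff flip: poly_eq_poly_eq_iff)
  then show "e (coeff p n) = e (coeff q n)"
    using zero[OF e] by (metis coeff_map_poly)
qed

lemma eval_at_eval_at_separates:
  fixes p q :: "'a::ab_group_add poly poly"
  assumes sep: "\<And>x y :: 'a. (\<And>e. e \<in> S \<Longrightarrow> e x = e y) \<Longrightarrow> x = y"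
    and add: "\<And>e. e \<in> S \<Longrightarrow> additive e"
    and eq: "\<And>e y z. e \<in> S \<Longrightarrow> eval_at (eval_at e y) z p = eval_at (eval_at e y) z q"
  shows "p = q"
proof (rule eval_at_separates[of "{eval_at e y | e y. e \<in> S}"])
  fix u v :: "'a poly" assume "\<And>E. E \<in> {eval_at e y | e y. e \<in> S} \<Longrightarrow> E u = E v"
  then show "u = v"
    by (intro eval_at_separates[of S, OF sep]) (auto simp: additive.zero[OF add])
qed (use eq in auto)

section \<open>Values of the three terms of the commutator identity\<close>

context
  fixes e :: "'m::ab_group_add \<Rightarrow> complex" and act :: "'r::zero \<Rightarrow> 'm \<Rightarrow> 'm poly"
  assumes e: "additive e"
begin

interpretation additive e by (rule e)

lemma eval_mul_inner: "eval_at (eval_at e y) z (mul_inner q) = y * eval_at (eval_at e y) z q"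
  by (simp add: mul_inner_def eval_at_map_poly eval_at_pCons zero eval_at_mult)

lemma eval_act_lam_mu:
  assumes "act a 0 = 0"
  shows "eval_at (eval_at e y) z (act_lam_mu act a b v) =
    eval_at (\<lambda>w. eval_at e y (act a w)) z (act b v)"
  using assms by (simp add: act_lam_mu_def eval_at_map_poly)

lemma eval_act_mu_lam:
  assumes "act b 0 = 0"
  shows "eval_at (eval_at e y) z (act_mu_lam act b a v) =
    eval_at (\<lambda>w. eval_at e z (act b w)) y (act a v)"
  unfolding act_mu_lam_def
  by (subst eval_at_subst_op[where t = y])
    (simp_all add: additive_eval_at e eval_mul_inner eval_at_map_poly eval_at_pCons zero assms)

text \<open>Two substitutions are nested: multiplication by \<lambda> takes the value
  \<open>y\<close>, multiplication by \<lambda> + \<mu> the value \<open>y + z\<close>.\<close>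

lemma eval_act_bracket:
  fixes br :: "'r \<Rightarrow> 'r \<Rightarrow> 'r poly"
  assumes "act 0 v = 0"
  shows "eval_at (eval_at e y) z (act_bracket br act a b v) =
    eval_at (\<lambda>c. eval_at e (y + z) (act c v)) y (br a b)"
proof -
  have *: "eval_at (eval_at e y) z
      (subst_op (\<lambda>q. mul_inner q + pCons 0 q) (\<lambda>x. [:[:x:]:]) p) = eval_at e (y + z) p" for p
    by (subst eval_at_subst_op[where t = "y + z"])
      (simp_all add: additive_eval_at e eval_mul_inner eval_at_pCons zero algebra_simps
        additive.add[OF additive_eval_at[OF additive_eval_at[OF e]]])
  show ?thesis
    unfolding act_bracket_def
    by (subst eval_at_subst_op[where t = y])
      (simp_all add: additive_eval_at e eval_mul_inner * assms)
qed

end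

section \<open>The Lie conformal algebra of Block type\<close>

lemma eval_at_poly: "eval_at (\<lambda>p. poly p x) z f = poly (poly f [:z:]) x"
  by (induction f) (simp_all add: eval_at_pCons)

lemma additive_poly: "additive (\<lambda>p. poly p x)"
  by standard simp

lemma eval_at_minus_lam: "poly (poly (at_minus_lam p) [:z:]) x = poly p (- z)"
  by (simp add: at_minus_lam_def poly_pcompose flip: pcompose_altdef)

lemma eval_at_dd_plus_lam: "poly (poly (at_dd_plus_lam p) [:z:]) x = poly p (x + z)"
  by (simp add: at_dd_plus_lam_def poly_pcompose one_pCons add.commute flip: pcompose_altdef)

lemma poly_eqI_pointwise:
  fixes p q :: "'a::{comm_ring_1,ring_no_zero_divisors,ring_char_0} poly"
  assumes "\<And>x. poly p x = poly q x"
  shows "p = q"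
  using assms by (simp add: fun_eq_iff flip: poly_eq_poly_eq_iff)

section \<open>Coefficient functionals on the Block algebra\<close>

definition block_eval :: "nat \<Rightarrow> complex \<Rightarrow> block \<Rightarrow> complex" where
  "block_eval k x c = poly (Poly_Mapping.lookup c k) x"

lemma additive_block_eval: "additive (block_eval k x)"
  by standard (simp add: block_eval_def lookup_add)

lemma block_eval_0 [simp]: "block_eval k x 0 = 0"
  by (simp add: block_eval_def)

lemma block_eval_scale: "block_eval k x (block_scale p c) = poly p x * block_eval k x c"
  by (simp add: block_eval_def)

lemma block_eval_separates:
  assumes "\<And>k x. block_eval k x c = block_eval k x d"
  shows "c = d"
  using assms by (intro poly_mapping_eqI poly_eqI_pointwise) (simp add: block_eval_def)

text \<open>Removes the supports from the index sets, so that brackets of different elements become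
  sums over the same range.\<close>

lemma sum_keys_antidiagonal:
  fixes T :: "nat \<Rightarrow> nat \<Rightarrow> 'a::comm_monoid_add"
  assumes "finite A" "finite B" "\<And>i j. i \<notin> A \<or> j \<notin> B \<Longrightarrow> T i j = 0"
  shows "(\<Sum>i\<in>A. \<Sum>j\<in>B. if i + j = k then T i j else 0) = (\<Sum>i\<le>k. T i (k - i))"
proof -
  have "(\<Sum>j\<in>B. if i + j = k then T i j else 0) = (if i \<le> k then T i (k - i) else 0)" for i
  proof -
    have "(\<Sum>j\<in>B. if i + j = k then T i j else 0) =
        (\<Sum>j\<in>B. if j = k - i then (if i \<le> k then T i j else 0) else 0)"
      by (intro sum.cong) auto
    then show ?thesis
      using assms by (auto simp: sum.delta)
  qed
  then have "(\<Sum>i\<in>A. \<Sum>j\<in>B. if i + j = k then T i j else 0) =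
      (\<Sum>i\<in>A. if i \<le> k then T i (k - i) else 0)"
    by simp
  also have "\<dots> = (\<Sum>i\<in>A \<inter> {..k}. T i (k - i))"
    using assms(1) by (simp add: sum.inter_restrict)
  also have "\<dots> = (\<Sum>i\<le>k. T i (k - i))"
    using assms by (intro sum.mono_neutral_left) auto
  finally show ?thesis .
qed

lemma eval_block_bracket:
  "eval_at (block_eval k x) z (block_bracket a b) =
    (\<Sum>i\<le>k. block_eval i (- z) a * block_eval (k - i) (x + z) b *
      ((of_nat i + 1) * x + (of_nat k + 2) * z))"
proof -
  let ?T = "\<lambda>i j. block_eval i (- z) a * block_eval j (x + z) b *
      ((of_nat i + 1) * x + (of_nat (i + j) + 2) * z)"
  have e: "eval_at (block_eval k x) z (map_poly (Poly_Mapping.single s) P) =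
      (if s = k then poly (poly P [:z:]) x else 0)" for s P
    by (simp add: eval_at_map_poly block_eval_def lookup_single when_def eval_at_poly)
      (simp add: eval_at_altdef)
  have "eval_at (block_eval k x) z (block_bracket a b) =
      (\<Sum>i\<in>Poly_Mapping.keys a. \<Sum>j\<in>Poly_Mapping.keys b. if i + j = k then ?T i j else 0)"
    unfolding block_bracket_def
    unfolding additive.sum[OF additive_eval_at[OF additive_block_eval]] e
    by (intro sum.cong refl if_cong)
      (simp add: eval_at_minus_lam eval_at_dd_plus_lam block_eval_def algebra_simps)
  also have "\<dots> = (\<Sum>i\<le>k. ?T i (k - i))"
    by (rule sum_keys_antidiagonal) (auto simp: block_eval_def in_keys_iff)
  finally show ?thesis by simp
qed

lemma block_poly_eqI:
  assumes "\<And>k x z. eval_at (block_eval k x) z p = eval_at (block_eval k x) z q"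
  shows "p = q"
  by (rule eval_at_separates[of "{block_eval k x | k x. True}"])
    (use assms in \<open>auto intro: block_eval_separates\<close>)

lemma block_poly_poly_eqI:
  assumes "\<And>k x y z. eval_at (eval_at (block_eval k x) y) z p =
    eval_at (eval_at (block_eval k x) y) z q"
  shows "p = q"
  by (rule eval_at_eval_at_separates[of "{block_eval k x | k x. True}"])
    (use assms additive_block_eval in \<open>auto intro: block_eval_separates\<close>)

lemma eval_block_scale:
  "eval_at (block_eval k x) z (map_poly (block_scale p) q) = poly p x * eval_at (block_eval k x) z q"
proof -
  have "block_scale p 0 = 0"
    by (intro poly_mapping_eqI) simp
  then show ?thesis
    by (simp add: eval_at_map_poly block_eval_scale eval_at_mult)
qed

lemma sum_simplex_swap:
  fixes f :: "nat \<Rightarrow> nat \<Rightarrow> 'a::comm_monoid_add"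
  shows "(\<Sum>i\<le>k. \<Sum>j\<le>k - i. f i j) = (\<Sum>j\<le>k. \<Sum>i\<le>k - j. f i j)"
  by (simp add: sum.Sigma)
    (rule sum.reindex_bij_witness[where i = prod.swap and j = prod.swap], auto)

lemma lie_conformal_algebra_block: "lie_conformal_algebra block_scale block_bracket"
proof -
  interpret module block_scale by (rule module_block_scale)
  note E = additive_eval_at[OF additive_block_eval]
  note E_simps = additive.add[OF E] additive.minus[OF E] additive.diff[OF E]
  have zero: "block_bracket a 0 = 0" "block_bracket 0 a = 0" for a
    by (simp_all add: block_bracket_def)
  show ?thesis
  proof
    fix a b c :: block and w :: complex
    show "block_bracket (a + b) c = block_bracket a c + block_bracket b c"
      by (rule block_poly_eqI)
        (simp add: E_simps eval_block_bracket additive.add[OF additive_block_eval]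
          distrib_right sum.distrib)
    show "block_bracket a (b + c) = block_bracket a b + block_bracket a c"
      by (rule block_poly_eqI)
        (simp add: E_simps eval_block_bracket additive.add[OF additive_block_eval]
          distrib_right distrib_left sum.distrib)
    show "block_bracket (block_scale [:w:] a) b = map_poly (block_scale [:w:]) (block_bracket a b)"
      by (rule block_poly_eqI)
        (simp add: eval_block_scale eval_block_bracket block_eval_scale sum_distrib_left mult_ac)
    show "block_bracket a (block_scale [:w:] b) = map_poly (block_scale [:w:]) (block_bracket a b)"
      by (rule block_poly_eqI)
        (simp add: eval_block_scale eval_block_bracket block_eval_scale sum_distrib_left mult_ac)
    show "block_bracket (dd block_scale a) b = - pCons 0 (block_bracket a b)"
      by (rule block_poly_eqI)
        (simp add: E_simps eval_at_pCons eval_block_bracket dd_def block_eval_scale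
          sum_distrib_left sum_negf mult_ac)
    show "block_bracket a (dd block_scale b) =
        map_poly (dd block_scale) (block_bracket a b) + pCons 0 (block_bracket a b)"
      unfolding dd_def
      by (rule block_poly_eqI)
        (simp add: E_simps eval_at_pCons eval_block_bracket block_eval_scale eval_block_scale
          mult_ac flip: distrib_right, simp add: sum_distrib_left mult_ac)
    show "block_bracket a b = - subst_op (\<lambda>q. - pCons 0 q - map_poly (dd block_scale) q)
        (\<lambda>x. [:x:]) (block_bracket b a)"
    proof (rule block_poly_eqI)
      fix k x z
      \<comment> \<open>The substituted operator is -\<lambda> - \<partial>, with value
        \<open>- z - x\<close>.\<close>
      have "eval_at (block_eval k x) z
          (subst_op (\<lambda>q. - pCons 0 q - map_poly (dd block_scale) q) (\<lambda>x. [:x:]) (block_bracket b a))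
          = eval_at (block_eval k x) (- z - x) (block_bracket b a)"
        unfolding dd_def
        by (subst eval_at_subst_op[where t = "- z - x"])
          (simp_all add: E E_simps eval_at_pCons eval_block_scale algebra_simps)
      also have "\<dots> = (\<Sum>i\<le>k. block_eval i (z + x) b * block_eval (k - i) (- z) a *
          ((of_nat i + 1) * x - (of_nat k + 2) * (z + x)))"
        by (simp add: eval_block_bracket algebra_simps)
      \<comment> \<open>Reversing the sum matches it with the other bracket, because
        \<open>(k - i + 1) x - (k + 2) (z + x) = - ((i + 1) x + (k + 2) z)\<close>.\<close>
      also have "\<dots> = (\<Sum>i\<le>k. block_eval (k - i) (z + x) b * block_eval i (- z) a *
          ((of_nat (k - i) + 1) * x - (of_nat k + 2) * (z + x)))"
        by (rule sum.reindex_bij_witness[where i = "(-) k" and j = "(-) k"]) auto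
      also have "\<dots> = - eval_at (block_eval k x) z (block_bracket a b)"
        unfolding eval_block_bracket sum_negf[symmetric]
        by (intro sum.cong) (auto simp: of_nat_diff algebra_simps)
      finally show "eval_at (block_eval k x) z (block_bracket a b) = eval_at (block_eval k x) z
          (- subst_op (\<lambda>q. - pCons 0 q - map_poly (dd block_scale) q) (\<lambda>x. [:x:])
            (block_bracket b a))"
        by (simp add: E_simps)
    qed
    show "act_lam_mu block_bracket a b c =
        act_bracket block_bracket block_bracket a b c + act_mu_lam block_bracket b a c"
    proof (rule block_poly_poly_eqI)
      fix k x y z
      \<comment> \<open>General in \<open>a\<close>, \<open>b\<close>, \<open>y\<close>,
        \<open>z\<close>, so that it also yields the term with \<open>b\<close> acting last, where
        both pairs are interchanged.\<close>
      have L: "eval_at (eval_at (block_eval k x) y) z (act_lam_mu block_bracket a b c) =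
        (\<Sum>i\<le>k. \<Sum>j\<le>k - i. block_eval i (- y) a * block_eval j (- z) b *
          block_eval (k - i - j) (x + y + z) c *
          (((of_nat i + 1) * x + (of_nat k + 2) * y) *
           ((of_nat j + 1) * (x + y) + (of_nat (k - i) + 2) * z)))" for a b y z
        unfolding eval_act_lam_mu[where act = block_bracket, OF additive_block_eval zero(1)]
          eval_block_bracket[of k x y]
        by (subst eval_at_sum) (simp_all add: eval_block_bracket sum_distrib_left sum_distrib_right mult_ac)
      have "eval_at (eval_at (block_eval k x) y) z (act_mu_lam block_bracket b a c) =
          eval_at (eval_at (block_eval k x) z) y (act_lam_mu block_bracket b a c)"
        by (simp add: eval_act_mu_lam eval_act_lam_mu additive_block_eval zero)
      also have "\<dots> = (\<Sum>i\<le>k. \<Sum>j\<le>k - i. block_eval i (- y) a * block_eval j (- z) b *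
          block_eval (k - i - j) (x + y + z) c *
          (((of_nat j + 1) * x + (of_nat k + 2) * z) *
           ((of_nat i + 1) * (x + z) + (of_nat (k - j) + 2) * y)))"
        unfolding L by (subst sum_simplex_swap) (simp add: mult_ac add_ac diff_commute)
      finally have R: "eval_at (eval_at (block_eval k x) y) z (act_mu_lam block_bracket b a c) = \<dots>" .
      let ?f = "\<lambda>i j m. block_eval i (- y) a * block_eval j (- z) b * block_eval m (x + y + z) c *
          (((of_nat (i + j) + 1) * x + (of_nat k + 2) * (y + z)) *
           ((of_nat i + 1) * (- y - z) + (of_nat (i + j) + 2) * y))"
      \<comment> \<open>The factor \<open>1\<close> gives the summands the two-sided shape of
        \<open>eval_at_sum\<close>.\<close>
      have "(\<lambda>d. eval_at (block_eval k x) (y + z) (block_bracket d c)) =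
        (\<lambda>d. \<Sum>l\<le>k. 1 * block_eval l (- (y + z)) d * (block_eval (k - l) (x + y + z) c *
          ((of_nat l + 1) * x + (of_nat k + 2) * (y + z))))"
        by (simp add: eval_block_bracket mult.assoc add.assoc)
      then have "eval_at (eval_at (block_eval k x) y) z (act_bracket block_bracket block_bracket a b c) =
          (\<Sum>l\<le>k. eval_at (block_eval l (- (y + z))) y (block_bracket a b) *
            (block_eval (k - l) (x + y + z) c *
              ((of_nat l + 1) * x + (of_nat k + 2) * (y + z))))"
        by (simp only: eval_act_bracket additive_block_eval zero) (subst eval_at_sum, simp_all)
      also have "\<dots> = (\<Sum>l\<le>k. \<Sum>i\<le>l. ?f i (l - i) (k - l))"
        by (intro sum.cong refl) (simp add: eval_block_bracket sum_distrib_left sum_distrib_right mult_ac)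
      \<comment> \<open>Reindexing by \<open>l = i + j\<close>, as in the associativity of the
        Cauchy product.\<close>
      also have "\<dots> = (\<Sum>i\<le>k. \<Sum>j\<le>k - i. ?f i j (k - i - j))"
        unfolding atMost_atLeast0 by (rule fps_mult_assoc_lemma)
      finally have B: "eval_at (eval_at (block_eval k x) y) z
          (act_bracket block_bracket block_bracket a b c) = \<dots>" .
      show "eval_at (eval_at (block_eval k x) y) z (act_lam_mu block_bracket a b c) =
        eval_at (eval_at (block_eval k x) y) z
          (act_bracket block_bracket block_bracket a b c + act_mu_lam block_bracket b a c)"
        \<comment> \<open>All three terms are now sums over the same pairs, with the same product of
          values of \<open>a\<close>, \<open>b\<close>, \<open>c\<close> in each summand. What
          remains for each pair is a polynomial identity in \<open>x\<close>, \<open>y\<close>,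
          \<open>z\<close>.\<close>
        unfolding L additive.add[OF additive_eval_at[OF E]] R B
        unfolding sum.distrib[symmetric] distrib_left[symmetric]
        by (intro sum.cong refl arg_cong2[where f = times])
          (simp add: of_nat_diff, simp add: algebra_simps)
    qed
  qed
qed

section \<open>The modules \<open>M\<^bsub>\<Delta>,\<alpha>\<^esub>\<close>\<close>

lemma poly2_eqI_pointwise:
  fixes p q :: "complex poly poly"
  assumes "\<And>x z. poly (poly p [:z:]) x = poly (poly q [:z:]) x"
  shows "p = q"
  by (rule eval_at_separates[of "{\<lambda>p. poly p x | x. True}"])
    (auto intro!: poly_eqI_pointwise simp: eval_at_poly assms)

lemma eval_M_act:
  "eval_at (\<lambda>p. poly p x) z (M_act \<Delta> \<alpha> a q) =
    block_eval 0 (- z) a * poly q (x + z) * (x + \<alpha> + \<Delta> * z)"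
proof -
  have "eval_at (\<lambda>p. poly p x) z (M_act \<Delta> \<alpha> a q) =
      (\<Sum>i\<in>Poly_Mapping.keys a. if i = 0 then
        block_eval 0 (- z) a * poly q (x + z) * (x + \<alpha> + \<Delta> * z) else 0)"
    unfolding M_act_def additive.sum[OF additive_eval_at[OF additive_poly]]
    by (intro sum.cong refl)
      (simp add: eval_at_poly eval_at_minus_lam eval_at_dd_plus_lam M_gen_def block_eval_def
        algebra_simps)
  then show ?thesis
    by (simp add: block_eval_def in_keys_iff)
qed

lemma conformal_module_M_act:
  "conformal_module block_scale block_bracket (*) (M_act \<Delta> \<alpha>)"
proof -
  interpret block: lie_conformal_algebra block_scale block_bracket
    by (rule lie_conformal_algebra_block)
  note E = additive_eval_at[OF additive_poly]
  note E_simps = additive.add[OF E] additive.minus[OF E] additive.diff[OF E]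
  have eqI: "p = q" if "\<And>x z. eval_at (\<lambda>p. poly p x) z p = eval_at (\<lambda>p. poly p x) z q"
    for p q :: "complex poly poly"
    using that by (intro poly2_eqI_pointwise) (simp add: eval_at_poly)
  have scale: "eval_at (\<lambda>p. poly p x) z (map_poly ((*) r) q) =
      poly r x * eval_at (\<lambda>p. poly p x) z q" for r q x z
    by (simp add: eval_at_map_poly eval_at_mult)
  have zero: "M_act \<Delta> \<alpha> 0 q = 0" "M_act \<Delta> \<alpha> a 0 = 0" for a q
    by (rule eqI, simp add: eval_M_act)+
  show ?thesis
  proof
    fix a b :: block and v w q :: "complex poly" and z :: complex
    show "v * (w + q) = v * w + v * q" "(v + w) * q = v * q + w * q" "v * (w * q) = v * w * q"
      "1 * v = v"
      by (simp_all add: algebra_simps)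
    show "M_act \<Delta> \<alpha> (a + b) v = M_act \<Delta> \<alpha> a v + M_act \<Delta> \<alpha> b v"
      by (rule eqI) (simp add: E_simps eval_M_act additive.add[OF additive_block_eval] algebra_simps)
    show "M_act \<Delta> \<alpha> a (v + w) = M_act \<Delta> \<alpha> a v + M_act \<Delta> \<alpha> a w"
      by (rule eqI) (simp add: E_simps eval_M_act algebra_simps)
    show "M_act \<Delta> \<alpha> (block_scale [:z:] a) v = map_poly ((*) [:z:]) (M_act \<Delta> \<alpha> a v)"
      by (rule eqI) (simp add: scale eval_M_act block_eval_scale)
    show "M_act \<Delta> \<alpha> a ([:z:] * v) = map_poly ((*) [:z:]) (M_act \<Delta> \<alpha> a v)"
      by (rule eqI) (simp add: scale eval_M_act)
    show "M_act \<Delta> \<alpha> (dd block_scale a) v = - pCons 0 (M_act \<Delta> \<alpha> a v)"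
      by (rule eqI) (simp add: E_simps eval_at_pCons eval_M_act dd_def block_eval_scale)
    show "M_act \<Delta> \<alpha> a (dd (*) v) = map_poly (dd (*)) (M_act \<Delta> \<alpha> a v) + pCons 0 (M_act \<Delta> \<alpha> a v)"
      unfolding dd_def
      by (rule eqI) (simp add: E_simps eval_at_pCons scale eval_M_act algebra_simps)
    show "act_lam_mu (M_act \<Delta> \<alpha>) a b v - act_mu_lam (M_act \<Delta> \<alpha>) b a v =
        act_bracket block_bracket (M_act \<Delta> \<alpha>) a b v"
    proof (rule eval_at_eval_at_separates[of "{\<lambda>p. poly p x | x. True}"], safe)
      fix x y z
      have m: "eval_at (\<lambda>w. c * poly w u * d) z p = c * eval_at (\<lambda>w. poly w u) z p * d"
        for c d u z p
        using eval_at_sum[of "{()}" "\<lambda>_ w. poly w u" "\<lambda>_. c" "\<lambda>_. d"] by simp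
      have m': "eval_at (\<lambda>w. block_eval 0 u w * c * d) z p =
          eval_at (block_eval 0 u) z p * c * d" for c d u z p
        using eval_at_sum[of "{()}" "\<lambda>_. block_eval 0 u" "\<lambda>_. 1" "\<lambda>_. c * d"]
        by (simp add: mult.assoc)
      \<comment> \<open>The action sees only the \<open>J 0\<close> component, and for
        \<open>k = 0\<close> the sum in \<open>eval_block_bracket\<close> has the single index 0.
        This leaves the Virasoro identity.\<close>
      show "eval_at (eval_at (\<lambda>p. poly p x) y) z
          (act_lam_mu (M_act \<Delta> \<alpha>) a b v - act_mu_lam (M_act \<Delta> \<alpha>) b a v) =
        eval_at (eval_at (\<lambda>p. poly p x) y) z (act_bracket block_bracket (M_act \<Delta> \<alpha>) a b v)"
        unfolding additive.diff[OF additive_eval_at[OF E]]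
          eval_act_lam_mu[where act = "M_act \<Delta> \<alpha>", OF additive_poly zero(2)]
          eval_act_mu_lam[where act = "M_act \<Delta> \<alpha>", OF additive_poly zero(2)]
          eval_act_bracket[where act = "M_act \<Delta> \<alpha>", OF additive_poly zero(1)]
          eval_M_act m m' eval_block_bracket
        by (simp add: algebra_simps)
    qed (auto intro: poly_eqI_pointwise additive_poly)
  qed
qed

lemma nontrivial_M_act: "nontrivial_action (M_act \<Delta> \<alpha>)"
  unfolding nontrivial_action_def by (intro exI[of _ "J 0"] exI[of _ 1]) (simp add: M_act_J)

lemma free_rank_one_poly:
  "free_rank_one ((*) :: complex poly \<Rightarrow> complex poly \<Rightarrow> complex poly)"
proof -
  interpret module "(*) :: complex poly \<Rightarrow> complex poly \<Rightarrow> complex poly"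
    by standard (simp_all add: algebra_simps)
  have "independent {1}"
    by (simp add: dependent_explicit) (use subset_singletonD in fastforce)
  moreover have "span {1} = (UNIV :: complex poly set)"
    by (auto simp: span_singleton)
  ultimately show ?thesis
    unfolding free_rank_one_def by blast
qed

section \<open>The functional equations\<close>

text \<open>The monomials are eigenvectors of the Euler operator, so the differential equations
  below decouple into equations for single coefficients.\<close>

lemma coeff_X_mult_pderiv: "coeff ([:0, 1:] * pderiv p) k = of_nat k * coeff p k"
  by (cases k) (simp_all add: coeff_pderiv)

text \<open>\<open>J 0\<close> generates a Virasoro conformal algebra, and this is its
  classification in rank one. First \<open>F\<close> is shown to be affine in \<open>x\<close> with
  slope 1, then its constant term \<open>p\<close> is determined as a function of the second
  variable.\<close>

lemma virasoro_rank_one: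
  fixes f :: "complex poly poly"
  defines "F \<equiv> \<lambda>x z. poly (poly f [:z:]) x"
  assumes nz: "f \<noteq> 0"
    and eq: "\<And>x y z. F (x + y) z * F x y - F (x + z) y * F x z = (y - z) * F x (y + z)"
  shows "\<exists>\<Delta> \<alpha>. \<forall>x z. F x z = x + \<alpha> + \<Delta> * z"
proof -
  define A where "A u = map_poly (\<lambda>p. poly p u) f" for u
  have A: "poly (A u) z = F u z" for u z
    unfolding A_def F_def eval_at_poly[symmetric] eval_at_def ..
  \<comment> \<open>At a point \<open>x\<close> where the leading coefficient does not vanish,
    \<open>A x\<close> has the full degree \<open>n\<close>; at other points \<open>n\<close> is
    only an upper bound.\<close>
  have "finite {x. poly (lead_coeff f) x = 0}"
    using nz by (intro poly_roots_finite) simp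
  then obtain x where x: "poly (lead_coeff f) x \<noteq> 0"
    using ex_new_if_finite[of "{x. poly (lead_coeff f) x = 0}"] infinite_UNIV_char_0 by blast
  define n where "n = Polynomial.degree f"
  have deg_x: "Polynomial.degree (A x) = n"
    unfolding A_def n_def using x by (rule map_poly_degree_eq)
  have deg_le: "Polynomial.degree (A u) \<le> n" for u
    unfolding A_def n_def by (rule map_poly_degree_leq)
  have Ax: "A x \<noteq> 0"
    using x coeff_map_poly[of "\<lambda>p. poly p x" f n] unfolding A_def n_def by force
  \<comment> \<open>Compare degrees in \<open>z\<close> in the functional equation: the left factor of
    \<open>F (x + z) y * F x z\<close> is \<open>z\<close> plus a constant.\<close>
  have lin: "\<exists>c. \<forall>w. F w y = w + c" for y
  proof -
    \<comment> \<open>Taking \<open>z\<close> away from the left factor leaves \<open>z D\<close> on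
      the other side. The leading terms of \<open>A x\<close> and its shift cancel in
      \<open>D\<close>, so \<open>z D\<close> stays within degree \<open>n\<close>.\<close>
    define Q where "Q = pcompose (poly f [:y:]) [:x, 1:] - [:0, 1:]"
    define D where "D = pcompose (A x) [:y, 1:] - A x"
    have deg_D: "Polynomial.degree ([:0, 1:] * D) \<le> n"
    proof (cases "D = 0")
      case False
      have "Polynomial.degree (pcompose (A x) [:y, 1:]) = n"
        by (simp add: degree_pcompose deg_x)
      moreover have "coeff (pcompose (A x) [:y, 1:]) n = coeff (A x) n"
        using lead_coeff_comp[of "[:y, 1:]" "A x"] by (simp add: degree_pcompose deg_x)
      ultimately have "Polynomial.degree D \<le> n" "coeff D n = 0"
        unfolding D_def using deg_x by (auto intro: degree_diff_le)
      with False have "Polynomial.degree D < n"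
        by (metis le_neq_implies_less leading_coeff_0_iff)
      then show ?thesis
        using False by (simp add: degree_mult_eq)
    qed simp
    have "Q * A x = smult (F x y) (A (x + y)) - smult y (pcompose (A x) [:y, 1:]) + [:0, 1:] * D"
    proof (rule poly_eqI_pointwise)
      fix z
      show "poly (Q * A x) z =
        poly (smult (F x y) (A (x + y)) - smult y (pcompose (A x) [:y, 1:]) + [:0, 1:] * D) z"
        using eq[of x y z]
        by (simp add: Q_def D_def A poly_pcompose F_def[symmetric]) (simp add: F_def algebra_simps)
    qed
    also have "Polynomial.degree \<dots> \<le> n"
      using deg_D deg_le[of "x + y"] degree_smult_le[of "F x y" "A (x + y)"]
        degree_smult_le[of y "pcompose (A x) [:y, 1:]"] deg_x
      by (intro degree_add_le degree_diff_le) (auto simp: degree_pcompose)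
    finally have "Polynomial.degree Q = 0"
      using Ax deg_x by (cases "Q = 0") (auto simp: degree_mult_eq)
    then obtain c where c: "Q = [:c:]"
      by (rule degree_eq_zeroE)
    have "F w y = w + (c - x)" for w
      using arg_cong[OF c, of "\<lambda>q. poly q (w - x)"]
      by (simp add: Q_def poly_pcompose F_def algebra_simps)
    then show ?thesis by blast
  qed
  define p where "p = A 0"
  have Fp: "F w y = w + poly p y" for w y
    using lin[of y] by (metis A add_0 p_def)
  \<comment> \<open>The functional equation at \<open>x = 0\<close>, where the mixed products
    cancel, read as an identity of polynomials in \<open>z\<close>.\<close>
  have p: "[:y * poly p y:] - [:0, 1:] * p = [:y, -1:] * pcompose p [:y, 1:]" for y
  proof (rule poly_eqI_pointwise)
    fix z
    show "poly ([:y * poly p y:] - [:0, 1:] * p) z = poly ([:y, -1:] * pcompose p [:y, 1:]) z"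
      using eq[of 0 y z] by (simp add: Fp poly_pcompose algebra_simps)
  qed
  \<comment> \<open>Differentiate in \<open>z\<close> at \<open>z = 0\<close>.\<close>
  have "[:0, 1:] * pderiv p = p - [:poly p 0:]"
  proof (rule poly_eqI_pointwise)
    fix y
    show "poly ([:0, 1:] * pderiv p) y = poly (p - [:poly p 0:]) y"
      using arg_cong[OF p[of y], of "\<lambda>q. poly (pderiv q) 0"]
      by (simp add: pderiv_mult pderiv_add pderiv_diff pderiv_smult pderiv_minus pderiv_pcompose
          pderiv_pCons poly_pcompose algebra_simps)
  qed
  then have coeff_eq: "of_nat k * coeff p k = coeff (p - [:poly p 0:]) k" for k
    unfolding coeff_X_mult_pderiv[symmetric] by simp
  \<comment> \<open>For \<open>k >= 2\<close> the coefficient equation reads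
    \<open>k * coeff p k = coeff p k\<close>.\<close>
  have "p = [:coeff p 0, coeff p 1:]"
  proof (rule poly_eqI)
    fix k
    show "coeff p k = coeff [:coeff p 0, coeff p 1:] k"
      using coeff_eq[of k] by (cases k; cases "k - 1") (auto simp: algebra_simps)
  qed
  then have "poly p z = coeff p 0 + coeff p 1 * z" for z
    by (metis poly_pCons poly_0 mult_zero_right add.right_neutral mult.commute)
  then show ?thesis
    by (intro exI[of _ "coeff p 1"] exI[of _ "coeff p 0"]) (simp add: Fp)
qed

text \<open>The hypothesis is the functional equation of \<open>J 0\<close> and \<open>J j\<close>
  with \<open>F 0\<close> inserted and \<open>n = j + 1\<close>; \<open>J j\<close> is primary of
  weight \<open>j + 2\<close>. Shifting by \<alpha> makes the equation for \<open>G\<close>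
  homogeneous, and setting the last variable to 0 expresses \<open>F\<close> through
  \<open>G\<close>.\<close>

lemma primary_field_rank_one:
  fixes f :: "complex poly poly" and n :: nat
  defines "F \<equiv> \<lambda>x z. poly (poly f [:z:]) x"
  assumes eq: "\<And>x y z. F (x + y) z * (x + \<alpha> + \<Delta> * y) - (x + z + \<alpha> + \<Delta> * y) * F x z =
      (of_nat n * y - z) * F x (y + z)"
  shows "\<exists>c. \<forall>x. F (x - \<alpha>) 0 = c * x ^ n \<and>
    (\<forall>z. of_nat n * z * F (x - \<alpha>) z = c * (x + \<Delta> * z) * ((x + z) ^ n - x ^ n))"
proof -
  define G where "G = pcompose (poly f [:0:]) [:- \<alpha>, 1:]"
  have G: "poly G x = F (x - \<alpha>) 0" for x
    by (simp add: G_def F_def poly_pcompose)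
  have eq0: "of_nat n * z * F (x - \<alpha>) z = (x + \<Delta> * z) * (poly G (x + z) - poly G x)" for x z
    using eq[of "x - \<alpha>" z 0] by (simp add: G algebra_simps)
  \<comment> \<open>Differentiate \<open>eq0\<close> in \<open>z\<close> at 0: the difference of
    values of \<open>G\<close> vanishes there, so \<Delta> drops out.\<close>
  have euler: "x * poly (pderiv G) x = of_nat n * poly G x" for x
  proof -
    let ?a = "map_poly (\<lambda>p. poly p (x - \<alpha>)) f"
    have a: "poly ?a z = F (x - \<alpha>) z" for z
      unfolding F_def eval_at_poly[symmetric] eval_at_def ..
    have "[:0, of_nat n:] * ?a = [:x, \<Delta>:] * (pcompose G [:x, 1:] - [:poly G x:])"
    proof (rule poly_eqI_pointwise)
      fix z
      show "poly ([:0, of_nat n:] * ?a) z = poly ([:x, \<Delta>:] * (pcompose G [:x, 1:] - [:poly G x:])) z"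
        using eq0[of z x] by (simp add: a poly_pcompose algebra_simps)
    qed
    from arg_cong[OF this, of "\<lambda>q. poly (pderiv q) 0"] show ?thesis
      by (simp add: pderiv_mult pderiv_add pderiv_diff pderiv_smult pderiv_minus pderiv_pcompose
          pderiv_pCons poly_pcompose a G)
  qed
  have "[:0, 1:] * pderiv G = smult (of_nat n) G"
    by (rule poly_eqI_pointwise) (simp add: euler)
  then have "of_nat k * coeff G k = of_nat n * coeff G k" for k
    unfolding coeff_X_mult_pderiv[symmetric] by simp
  then have "G = monom (coeff G n) n"
    by (intro poly_eqI) auto
  then have Gn: "poly G x = coeff G n * x ^ n" for x
    by (metis poly_monom)
  show ?thesis
    by (intro exI[of _ "coeff G n"] allI conjI, unfold eq0 Gn[symmetric] G[symmetric])
      (simp_all add: Gn algebra_simps)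
qed

text \<open>The equation expresses the compatibility of \<open>F i\<close> with
  \<open>F (i + i)\<close> for \<open>n = i + 1\<close>, where \<open>c\<close> and \<open>d\<close>
  are the constants that determine these two functions.\<close>

lemma geometric_sum_eq_imp_zero:
  fixes c d \<Delta> :: complex and n :: nat
  assumes n: "n \<ge> 2"
    and eq: "\<And>u. (1 + \<Delta> * (u - 1)) * (of_nat (2 * n - 1) * c\<^sup>2 * (u ^ n - 1)\<^sup>2) =
      (1 + \<Delta> * (u - 1)) * ((of_nat n)\<^sup>2 * d * (u - 1) * (u ^ (2 * n - 1) - 1))"
  shows "c = 0"
proof -
  define S :: "nat \<Rightarrow> complex poly" where "S m = (\<Sum>k<m. monom 1 k)" for m
  have S: "(u - 1) * poly (S m) u = u ^ m - 1" for u m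
    using power_diff_1_eq[of u m] by (simp add: S_def poly_sum poly_monom)
  have S1: "poly (S m) 1 = of_nat m" for m
    by (simp add: S_def poly_sum poly_monom)
  have S0: "poly (S m) 0 = 1" if "m > 0" for m
    using that by (simp add: S_def poly_sum poly_monom power_0_left)
  \<comment> \<open>Cancel \<open>(1 + \<Delta> (u - 1)) (u - 1)\<^sup>2\<close> and compare the values at \<open>u = 1\<close> and \<open>u = 0\<close>.\<close>
  let ?r = "[:1 - \<Delta>, \<Delta>:] * [:-1, 1:] * [:-1, 1:]"
  have "?r * smult (of_nat (2 * n - 1) * c\<^sup>2) (S n * S n) =
      ?r * smult ((of_nat n)\<^sup>2 * d) (S (2 * n - 1))"
  proof (rule poly_eqI_pointwise)
    fix u
    have r: "poly ?r u = (1 + \<Delta> * (u - 1)) * (u - 1) * (u - 1)"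
      by (simp add: algebra_simps)
    show "poly (?r * smult (of_nat (2 * n - 1) * c\<^sup>2) (S n * S n)) u =
        poly (?r * smult ((of_nat n)\<^sup>2 * d) (S (2 * n - 1))) u"
      using eq[of u] unfolding S[symmetric] poly_mult[of ?r] r
      by (simp only: poly_mult poly_smult power2_eq_square mult_ac)
  qed
  \<comment> \<open>The factor \<open>[:1 - \<Delta>, \<Delta>:]\<close> is nonzero for every
    \<Delta>, since its coefficients sum to 1.\<close>
  then have *: "smult (of_nat (2 * n - 1) * c\<^sup>2) (S n * S n) =
      smult ((of_nat n)\<^sup>2 * d) (S (2 * n - 1))"
    by (subst (asm) mult_left_cancel) (auto simp: pCons_eq_0_iff)
  have pos: "of_nat n \<noteq> (0::complex)" "of_nat (2 * n - 1) \<noteq> (0::complex)"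
    unfolding of_nat_eq_0_iff using n by simp_all
  have "of_nat (2 * n - 1) * c\<^sup>2 * (of_nat n * of_nat n) = (of_nat n)\<^sup>2 * d * of_nat (2 * n - 1)"
    using arg_cong[OF *, of "\<lambda>q. poly q 1"] by (simp add: S1)
  then have d: "d = c\<^sup>2"
    using pos by (simp add: power2_eq_square)
  have "of_nat (2 * n - 1) * c\<^sup>2 = (of_nat n)\<^sup>2 * d"
    using arg_cong[OF *, of "\<lambda>q. poly q 0"] n by (simp add: S0)
  then have "(of_nat n - 1)\<^sup>2 * c\<^sup>2 = 0"
    using n by (simp add: d of_nat_diff power2_eq_square algebra_simps)
  moreover have "of_nat n - 1 \<noteq> (0::complex)"
    using n by (metis One_nat_def eq_iff_diff_eq_0 not_less_eq_eq numeral_2_eq_2 of_nat_1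
        of_nat_eq_iff order_refl)
  ultimately show ?thesis by simp
qed

section \<open>Modules of rank one\<close>

text \<open>Freeness of rank one enters as bijectivity of \<open>p\<close> to \<open>sM p v\<close>,
  which identifies the module with the polynomials in \<partial>.\<close>

locale rank_one_block_module = conformal_module block_scale block_bracket sM act
  for sM :: "complex poly \<Rightarrow> 'm::ab_group_add \<Rightarrow> 'm" and act :: "block \<Rightarrow> 'm \<Rightarrow> 'm poly" +
  fixes v :: 'm
  assumes bij_gen: "bij (\<lambda>p. sM p v)"
begin

section \<open>Coordinates with respect to the generator\<close>

definition coord :: "'m \<Rightarrow> complex poly" where
  "coord = inv (\<lambda>p. sM p v)"

lemma coord_scale_gen [simp]: "coord (sM p v) = p"
  unfolding coord_def using bij_gen by (rule inv_f_f[OF bij_is_inj])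

lemma scale_coord_gen [simp]: "sM (coord w) v = w"
  unfolding coord_def using bij_gen by (rule surj_f_inv_f[OF bij_is_surj])

lemma coord_add: "coord (w + w') = coord w + coord w'"
  by (metis M.scale_left_distrib coord_scale_gen scale_coord_gen)

lemma coord_scale: "coord (sM p w) = p * coord w"
  by (metis M.scale_scale coord_scale_gen scale_coord_gen)

definition point_eval :: "complex \<Rightarrow> 'm \<Rightarrow> complex" where
  "point_eval x w = poly (coord w) x"

lemma additive_point_eval: "additive (point_eval x)"
  by standard (simp add: point_eval_def coord_add)

lemmas additive_E = additive_eval_at[OF additive_point_eval]
lemmas E_simps = additive.add[OF additive_E] additive.minus[OF additive_E]

lemma point_eval_0: "point_eval x 0 = 0"
  by (rule additive.zero[OF additive_point_eval])

lemma point_eval_scale: "point_eval x (sM p w) = poly p x * point_eval x w"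
  by (simp add: point_eval_def coord_scale)

lemma eval_scale:
  "eval_at (point_eval x) z (map_poly (sM p) q) = poly p x * eval_at (point_eval x) z q"
  by (simp add: eval_at_map_poly point_eval_0 point_eval_scale eval_at_mult)

lemma poly_eqI_point_eval:
  assumes "\<And>x z. eval_at (point_eval x) z p = eval_at (point_eval x) z q"
  shows "p = q"
proof (rule eval_at_separates[of "range point_eval"])
  fix w w' assume *: "\<And>e. e \<in> range point_eval \<Longrightarrow> e w = e w'"
  have "coord w = coord w'"
    using *[OF rangeI] by (intro poly_eqI_pointwise) (simp add: point_eval_def)
  then show "w = w'"
    by (metis scale_coord_gen)
qed (use assms point_eval_0 in auto)

lemma act_zero_right: "act a 0 = 0"
  using act_add_right[of a 0 0] by simp

lemma act_zero_left: "act 0 w = 0"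
  using act_add_left[of 0 0 w] by simp

lemma eval_act_scale_right:
  "eval_at (point_eval x) z (act a (sM p w)) = poly p (x + z) * eval_at (point_eval x) z (act a w)"
proof (induction p)
  case 0
  then show ?case by (simp add: act_zero_right)
next
  case (pCons c p)
  \<comment> \<open>Horner's scheme reduces a general polynomial to the axioms for scalars and for
    \<partial>.\<close>
  have "sM (pCons c p) w = sM [:c:] w + dd sM (sM p w)"
    by (simp add: dd_def flip: M.scale_left_distrib)
  then show ?case
    unfolding dd_def
    by (simp add: act_add_right act_scale_right act_dd_right[unfolded dd_def] E_simps eval_at_pCons
        point_eval_0 eval_scale pCons.IH algebra_simps del: M.scale_scale)
qed

lemma eval_act_scale_left:
  "eval_at (point_eval x) z (act (block_scale p a) w) =
    poly p (- z) * eval_at (point_eval x) z (act a w)"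
proof (induction p)
  case 0
  then show ?case by (simp add: act_zero_left)
next
  case (pCons c p)
  have "block_scale (pCons c p) a = block_scale [:c:] a + dd block_scale (block_scale p a)"
    by (simp add: dd_def flip: scale_left_distrib)
  then show ?case
    by (simp add: act_add_left act_scale_left act_dd_left E_simps eval_at_pCons point_eval_0
        eval_scale pCons.IH algebra_simps)
qed

section \<open>The action on the generator and its functional equation\<close>

definition gen_act :: "nat \<Rightarrow> complex poly poly" where
  "gen_act i = map_poly coord (act (J i) v)"

definition F :: "nat \<Rightarrow> complex \<Rightarrow> complex \<Rightarrow> complex" where
  "F i x z = poly (poly (gen_act i) [:z:]) x"

lemma coord_0 [simp]: "coord 0 = 0"
  using coord_add[of 0 0] by simp

lemma eval_act_gen: "eval_at (point_eval x) z (act (J i) v) = F i x z"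
proof -
  have "point_eval x = (\<lambda>w. poly (coord w) x)"
    by (simp add: fun_eq_iff point_eval_def)
  then show ?thesis
    by (simp add: F_def gen_act_def eval_at_map_poly flip: eval_at_poly)
qed

lemma eval_act:
  "eval_at (point_eval x) z (act a (sM p v)) =
    poly p (x + z) * (\<Sum>i\<in>Poly_Mapping.keys a. block_eval i (- z) a * F i x z)"
proof -
  interpret L: additive "\<lambda>a. eval_at (point_eval x) z (act a v)"
    by standard (simp add: act_add_left E_simps)
  have "eval_at (point_eval x) z (act a v) =
      (\<Sum>i\<in>Poly_Mapping.keys a. block_eval i (- z) a * F i x z)"
    by (subst (1) block_expand)
      (simp add: L.sum eval_act_scale_left eval_act_gen block_eval_def)
  then show ?thesis
    by (simp add: eval_act_scale_right)
qed

text \<open>Inside the bracket \<partial> acts as \<open>- (y + z)\<close>, so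
  \<open>(i + 1) \<partial> + (i + j + 2) \<lambda>\<close> takes the value
  \<open>(j + 1) y - (i + 1) z\<close>.\<close>

lemma functional_equation:
  "F i x y * F j (x + y) z - F j x z * F i (x + z) y =
    ((of_nat j + 1) * y - (of_nat i + 1) * z) * F (i + j) x (y + z)"
proof -
  \<comment> \<open>In coordinates \<open>J i\<close> multiplies by \<open>F i x y\<close> and
    shifts \<partial> by \<open>y\<close>.\<close>
  have comp: "eval_at (\<lambda>w. eval_at (point_eval x) y (act (J i) w)) z (act (J j) v) =
      F i x y * F j (x + y) z" for i j y z
  proof -
    have "eval_at (point_eval x) y (act (J i) w) = F i x y * point_eval (x + y) w" for w
      using eval_act_scale_right[of x y "J i" "coord w" v]
      by (simp add: eval_act_gen point_eval_def)
    then show ?thesis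
      by (simp add: eval_at_mult point_eval_0 eval_act_gen)
  qed
  have single: "Poly_Mapping.single k p = block_scale p (J k)" for k p
    by (intro poly_mapping_eqI) (simp add: J_def lookup_single when_def)
  have "eval_at (eval_at (point_eval x) y) z (act_bracket block_bracket act (J i) (J j) v) =
      ((of_nat j + 1) * y - (of_nat i + 1) * z) * F (i + j) x (y + z)"
    unfolding eval_act_bracket[where act = act, OF additive_point_eval act_zero_left]
      block_bracket_J single
    by (simp add: eval_at_pCons act_zero_left eval_act_scale_left eval_act_gen)
      (simp add: algebra_simps)
  moreover have "eval_at (eval_at (point_eval x) y) z (act_bracket block_bracket act (J i) (J j) v) =
      F i x y * F j (x + y) z - F j x z * F i (x + z) y"
    unfolding act_commutator[symmetric] additive.diff[OF additive_eval_at[OF additive_E]]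
      eval_act_lam_mu[where act = act, OF additive_point_eval act_zero_right]
      eval_act_mu_lam[where act = act, OF additive_point_eval act_zero_right] comp ..
  ultimately show ?thesis by simp
qed

section \<open>Classification\<close>

lemma gen_act_0_nonzero:
  assumes "nontrivial_action act"
  shows "gen_act 0 \<noteq> 0"
proof
  assume "gen_act 0 = 0"
  then have F0: "F 0 x z = 0" for x z
    by (simp add: F_def)
  have "F j x s = 0" for j x s
  proof -
    \<comment> \<open>Chosen so that the coefficient of \<open>F j x s\<close> in the functional
      equation for \<open>J 0\<close> and \<open>J j\<close> becomes 1.\<close>
    define y :: complex where "y = (s + 1) / (of_nat j + 2)"
    have j: "of_nat j + 2 \<noteq> (0::complex)"
      by (metis of_nat_add of_nat_eq_0_iff of_nat_numeral add_is_0 zero_neq_numeral)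
    have "(of_nat j + 1) * y - (s - y) = (of_nat j + 2) * y - s"
      by (simp add: algebra_simps)
    also have "\<dots> = 1"
      using j by (simp add: y_def)
    finally show ?thesis
      using functional_equation[of 0 x y j "s - y"] by (simp add: F0)
  qed
  then have "act a w = 0" for a w
    using eval_act[of _ _ a "coord w"] by (intro poly_eqI_point_eval) simp
  with assms show False
    by (simp add: nontrivial_action_def)
qed

lemma F_pos_eq_0:
  assumes F0: "\<And>x z. F 0 x z = x + \<alpha> + \<Delta> * z" and i: "i > 0"
  shows "F i x z = 0"
proof -
  have "\<exists>c. \<forall>x. F j (x - \<alpha>) 0 = c * x ^ (j + 1) \<and> (\<forall>z. of_nat (j + 1) * z * F j (x - \<alpha>) z =
      c * (x + \<Delta> * z) * ((x + z) ^ (j + 1) - x ^ (j + 1)))" for j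
    unfolding F_def
    by (rule primary_field_rank_one, fold F_def)
      (use functional_equation[of 0 _ _ j] in \<open>simp add: F0 algebra_simps\<close>)
  then obtain C where G: "F j (x - \<alpha>) 0 = C j * x ^ (j + 1)"
    and C: "of_nat (j + 1) * z * F j (x - \<alpha>) z =
      C j * (x + \<Delta> * z) * ((x + z) ^ (j + 1) - x ^ (j + 1))" for j x z
    by metis
  define n where "n = i + 1"
  have n: "n \<ge> 2" "i + i + 1 = 2 * n - 1" "of_nat n \<noteq> (0::complex)"
    using i by (simp_all add: n_def del: of_nat_add of_nat_Suc)
  have "C i = 0"
  proof (rule geometric_sum_eq_imp_zero[OF n(1)])
    fix u
    \<comment> \<open>At the point \<open>1 - \<alpha>\<close> with increment \<open>u - 1\<close>
      the shifted variable moves from 1 to \<open>u\<close>, which produces the differences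
      \<open>u ^ n - 1\<close>.\<close>
    define w P Q h N where "w = 1 + \<Delta> * (u - 1)" and "P = F i (1 - \<alpha>) (u - 1)"
      and "Q = F (i + i) (1 - \<alpha>) (u - 1)" and "h = u - 1"
      and "N = (of_nat (2 * n - 1) :: complex)"
    have 1: "of_nat n * h * P = C i * w * (u ^ n - 1)"
      using C[of i "u - 1" 1] by (simp add: P_def h_def w_def n_def)
    have 2: "N * h * Q = C (i + i) * w * (u ^ (2 * n - 1) - 1)"
      using C[of "i + i" "u - 1" 1] unfolding n(2) Q_def h_def w_def N_def by simp
    \<comment> \<open>The functional equation for the pair \<open>i\<close>, \<open>i\<close> with
      last variable 0 links \<open>F i\<close> to \<open>F (i + i)\<close>.\<close>
    have 3: "P * (C i * (u ^ n - 1)) = of_nat n * h * Q"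
      using functional_equation[of i "1 - \<alpha>" "u - 1" i 0] G[of i u] G[of i 1]
      unfolding P_def Q_def h_def n_def by (simp add: algebra_simps)
    have "w * (N * (C i)\<^sup>2 * (u ^ n - 1)\<^sup>2) = N * C i * (u ^ n - 1) * (of_nat n * h * P)"
      unfolding 1 by (simp add: power2_eq_square)
    also have "\<dots> = N * of_nat n * h * (of_nat n * h * Q)"
      unfolding 3[symmetric] by (simp add: mult_ac)
    also have "\<dots> = (of_nat n)\<^sup>2 * h * (N * h * Q)"
      by (simp add: power2_eq_square)
    finally show "w * (N * (C i)\<^sup>2 * (u ^ n - 1)\<^sup>2) =
        w * ((of_nat n)\<^sup>2 * C (i + i) * h * (u ^ (2 * n - 1) - 1))"
      unfolding 2 by (simp add: mult_ac)
  qed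
  \<comment> \<open>The relation \<open>C\<close> carries a factor \<open>z\<close> and says nothing
    at \<open>z = 0\<close>; there \<open>G\<close> takes over.\<close>
  have nz: "F i x z = 0" if "z \<noteq> 0" for x z
    using C[of i z "x + \<alpha>"] that n(3) by (simp add: \<open>C i = 0\<close> n_def)
  show ?thesis
    using nz G[of i "x + \<alpha>"] \<open>C i = 0\<close> by (cases "z = 0") auto
qed

text \<open>The isomorphism sends \<open>p\<close> to \<open>sM p v\<close>. By
  \<open>eval_act\<close> the functions \<open>F i\<close> fix the whole action, and only
  \<open>F 0\<close> survives.\<close>

lemma isomorphic_M_act:
  assumes "nontrivial_action act"
  shows "\<exists>\<Delta> \<alpha>. conformal_module_isomorphic (*) (M_act \<Delta> \<alpha>) sM act"
proof -
  have "\<exists>\<Delta> \<alpha>. \<forall>x z. F 0 x z = x + \<alpha> + \<Delta> * z"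
    unfolding F_def
    by (rule virasoro_rank_one[OF gen_act_0_nonzero[OF assms]], fold F_def)
      (use functional_equation[of 0 _ _ 0] in \<open>simp add: mult.commute\<close>)
  then obtain \<Delta> \<alpha> where F0: "\<And>x z. F 0 x z = x + \<alpha> + \<Delta> * z"
    by blast
  have "map_poly (\<lambda>p. sM p v) (M_act \<Delta> \<alpha> a p) = act a (sM p v)" for a p
  proof (rule poly_eqI_point_eval)
    fix x z
    have "(\<Sum>i\<in>Poly_Mapping.keys a. block_eval i (- z) a * F i x z) =
        (\<Sum>i\<in>Poly_Mapping.keys a. if i = 0 then block_eval 0 (- z) a * F 0 x z else 0)"
      using F_pos_eq_0[OF F0] by (intro sum.cong) auto
    also have "\<dots> = block_eval 0 (- z) a * F 0 x z"
      by (simp add: block_eval_def in_keys_iff)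
    finally show "eval_at (point_eval x) z (map_poly (\<lambda>p. sM p v) (M_act \<Delta> \<alpha> a p)) =
        eval_at (point_eval x) z (act a (sM p v))"
      unfolding eval_act
      by (simp add: eval_at_map_poly point_eval_0) (simp add: point_eval_def eval_M_act F0)
  qed
  moreover have "module_hom (*) sM (\<lambda>p. sM p v)"
    by standard (simp_all add: algebra_simps)
  ultimately show ?thesis
    unfolding conformal_module_isomorphic_def using bij_gen by blast
qed

end

lemma free_rank_one_bij:
  assumes "module s" "free_rank_one s"
  shows "\<exists>v. bij (\<lambda>p. s p v)"
proof -
  interpret module s by fact
  obtain v where v: "independent {v}" "span {v} = UNIV"
    using assms(2) by (auto simp: free_rank_one_def)
  \<comment> \<open>Otherwise \<open>p - q\<close> would be a nontrivial relation on
    \<open>{v}\<close>.\<close>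
  have "p = q" if "s p v = s q v" for p q
  proof (rule ccontr)
    assume "p \<noteq> q"
    then have "dependent {v}"
      using that unfolding dependent_explicit
      by (intro exI[of _ "{v}"] exI[of _ "\<lambda>_. p - q"]) (simp add: scale_left_diff_distrib)
    with v show False by simp
  qed
  moreover have "range (\<lambda>p. s p v) = UNIV"
    using v(2) by (simp add: span_singleton)
  ultimately show ?thesis
    by (auto simp: bij_def inj_on_def)
qed

theorem proposition4p2:
  fixes sM :: "complex poly \<Rightarrow> 'm::ab_group_add \<Rightarrow> 'm"
    and act :: "block \<Rightarrow> 'm \<Rightarrow> 'm poly"
  shows "(\<forall>\<Delta> \<alpha>. conformal_module block_scale block_bracket (*) (M_act \<Delta> \<alpha>) \<and>
            nontrivial_action (M_act \<Delta> \<alpha>) \<and>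
            free_rank_one ((*) :: complex poly \<Rightarrow> complex poly \<Rightarrow> complex poly)) \<and>
         (conformal_module block_scale block_bracket sM act \<and>
            nontrivial_action act \<and> free_rank_one sM \<longrightarrow>
          (\<exists>\<Delta> \<alpha>. conformal_module_isomorphic (*) (M_act \<Delta> \<alpha>) sM act))"
proof (intro conjI allI impI; (elim conjE)?)
  assume M: "conformal_module block_scale block_bracket sM act"
    and nt: "nontrivial_action act" and free: "free_rank_one sM"
  interpret M: conformal_module block_scale block_bracket sM act
    by (rule M)
  obtain v where "bij (\<lambda>p. sM p v)"
    using free_rank_one_bij[OF M.M.module_axioms free] by blast
  then interpret rank_one_block_module sM act v
    by unfold_locales
  show "\<exists>\<Delta> \<alpha>. conformal_module_isomorphic (*) (M_act \<Delta> \<alpha>) sM act"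
    using nt by (rule isomorphic_M_act)
qed (rule conformal_module_M_act nontrivial_M_act free_rank_one_poly)+

end
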